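(* Let $T$ be a Lie triple system and $N:T\to T$ a Nijenhuis operator for $T$. Then a deformation of $T$ is obtained by putting $$\omega(x_1,x_2,x_3)=[Nx_1,x_2,x_3]+[x_1,Nx_2,x_3]+[x_1,x_2,Nx_3]-N[x_1,x_2,x_3],$$ that is, $\omega$ generates a $\lambda$-parameter infinitesimal deformation of $T$. Furthermore, this deformation is trivial.
   Context: All vector spaces are over an algebraically closed field of characteristic different from 2 and 3. A Lie triple system is a vector space $T$ with a trilinear map $[\cdot,\cdot,\cdot]:T\times T\times T\to T$ such that, for all elements, $[x_1,x_1,x_2]=0$; $[x_1,x_2,x_3]+[x_2,x_3,x_1]+[x_3,x_1,x_2]=0$; and $[x_1,x_2,[y_1,y_2,y_3]]=[[x_1,x_2,y_1],y_2,y_3]+[y_1,[x_1,x_2,y_2],y_3]+[y_1,y_2,[x_1,x_2,y_3]]$. A linear operator $N:T\to T$ is a Nijenhuis operator if for all $x_1,x_2,x_3\in T$: $[Nx_1,Nx_2,Nx_3]=0$ and $$N^2[x_1,x_2,x_3]=N[Nx_1,x_2,x_3]+N[x_1,Nx_2,x_3]+N[x_1,x_2,Nx_3]-([Nx_1,Nx_2,x_3]+[Nx_1,x_2,Nx_3]+[x_1,Nx_2,Nx_3]).$$ For a trilinear $\omega:T\times T\times T\to T$ let $[x_1,x_2,x_3]_\lambda=[x_1,x_2,x_3]+\lambda\,\omega(x_1,x_2,x_3)$, with $\lambda$ a formal variable (operations are extended $\lambda$-linearly and identities are identities of polynomials in $\lambda$). $\omega$ generates a $\lambda$-parameter infinitesimal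 deformation of $T$ if $[\cdot,\cdot,\cdot]_\lambda$ satisfies the Lie triple system axioms. The deformation is trivial if there is a linear map $N':T\to T$ such that $\varphi_\lambda=\mathrm{id}+\lambda N'$ satisfies $\varphi_\lambda[x_1,x_2,x_3]_\lambda=[\varphi_\lambda x_1,\varphi_\lambda x_2,\varphi_\lambda x_3]$ for all $x_1,x_2,x_3\in T$. *)

theory Defs
  imports "HOL-Computational_Algebra.Computational_Algebra"
begin

definition trilinear ::
  "('r::comm_ring_1 \<Rightarrow> 'v::ab_group_add \<Rightarrow> 'v) \<Rightarrow> ('v \<Rightarrow> 'v \<Rightarrow> 'v \<Rightarrow> 'v) \<Rightarrow> bool"
where
  "trilinear scale f \<longleftrightarrow>
     (\<forall>y z. module_hom scale scale (\<lambda>x. f x y z)) \<and>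
     (\<forall>x z. module_hom scale scale (\<lambda>y. f x y z)) \<and>
     (\<forall>x y. module_hom scale scale (\<lambda>z. f x y z))"

text \<open>
  The axioms are stated for a module over a commutative ring, so that they can be imposed both on a
  vector space \<open>T\<close> over a field \<open>k\<close> (over a field, the locales \<open>module\<close> and \<open>vector_space\<close> agree)
  and on the \<open>k[\<lambda>]\<close>-module \<open>T[\<lambda>]\<close>.
\<close>

locale lie_triple_system = module scale
  for scale :: "'r::comm_ring_1 \<Rightarrow> 'v::ab_group_add \<Rightarrow> 'v" +
  fixes br :: "'v \<Rightarrow> 'v \<Rightarrow> 'v \<Rightarrow> 'v"
  assumes trilinear: "trilinear scale br"
    and alternating: "br x1 x1 x2 = 0"
    and cyclic: "br x1 x2 x3 + br x2 x3 x1 + br x3 x1 x2 = 0"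
    and derivation: "br x1 x2 (br y1 y2 y3) =
      br (br x1 x2 y1) y2 y3 + br y1 (br x1 x2 y2) y3 + br y1 y2 (br x1 x2 y3)"

definition nijenhuis_operator ::
  "('k::field \<Rightarrow> 'v::ab_group_add \<Rightarrow> 'v) \<Rightarrow> ('v \<Rightarrow> 'v \<Rightarrow> 'v \<Rightarrow> 'v) \<Rightarrow> ('v \<Rightarrow> 'v) \<Rightarrow> bool"
where
  "nijenhuis_operator scale br N \<longleftrightarrow>
     Vector_Spaces.linear scale scale N \<and>
     (\<forall>x1 x2 x3. br (N x1) (N x2) (N x3) = 0) \<and>
     (\<forall>x1 x2 x3. N (N (br x1 x2 x3)) =
        N (br (N x1) x2 x3) + N (br x1 (N x2) x3) + N (br x1 x2 (N x3))
        - (br (N x1) (N x2) x3 + br (N x1) x2 (N x3) + br x1 (N x2) (N x3)))"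

text \<open>
  \<open>T[\<lambda>]\<close> is the type \<open>'v poly\<close>: the coefficients lie in the additive group \<open>'v\<close>, \<open>monom v n\<close> is
  \<open>\<lambda>\<^sup>n v\<close>, \<open>[:v:]\<close> is \<open>v\<close> as a constant, and \<open>pCons 0\<close> is multiplication by \<open>\<lambda>\<close>.
\<close>

definition poly_scale ::
  "('k::comm_ring_1 \<Rightarrow> 'v::ab_group_add \<Rightarrow> 'v) \<Rightarrow> 'k poly \<Rightarrow> 'v poly \<Rightarrow> 'v poly"
where
  "poly_scale scale p X =
     (\<Sum>i\<le>degree p. \<Sum>j\<le>degree X. monom (scale (coeff p i) (coeff X j)) (i + j))"

text \<open>The \<open>\<lambda>\<close>-linear extension of a trilinear map from \<open>T\<close> to \<open>T[\<lambda>]\<close>.\<close>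

definition poly_extend3 ::
  "('v::ab_group_add \<Rightarrow> 'v \<Rightarrow> 'v \<Rightarrow> 'v) \<Rightarrow> 'v poly \<Rightarrow> 'v poly \<Rightarrow> 'v poly \<Rightarrow> 'v poly"
where
  "poly_extend3 f X Y Z =
     (\<Sum>i\<le>degree X. \<Sum>j\<le>degree Y. \<Sum>k\<le>degree Z.
        monom (f (coeff X i) (coeff Y j) (coeff Z k)) (i + j + k))"

definition deformed_bracket ::
  "('v::ab_group_add \<Rightarrow> 'v \<Rightarrow> 'v \<Rightarrow> 'v) \<Rightarrow> ('v \<Rightarrow> 'v \<Rightarrow> 'v \<Rightarrow> 'v) \<Rightarrow>
   'v poly \<Rightarrow> 'v poly \<Rightarrow> 'v poly \<Rightarrow> 'v poly"
where
  "deformed_bracket br \<omega> X Y Z = poly_extend3 br X Y Z + pCons 0 (poly_extend3 \<omega> X Y Z)"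

definition generates_deformation ::
  "('k::field \<Rightarrow> 'v::ab_group_add \<Rightarrow> 'v) \<Rightarrow> ('v \<Rightarrow> 'v \<Rightarrow> 'v \<Rightarrow> 'v) \<Rightarrow>
   ('v \<Rightarrow> 'v \<Rightarrow> 'v \<Rightarrow> 'v) \<Rightarrow> bool"
where
  "generates_deformation scale br \<omega> \<longleftrightarrow>
     trilinear scale \<omega> \<and> lie_triple_system (poly_scale scale) (deformed_bracket br \<omega>)"

text \<open>The \<open>\<lambda>\<close>-linear extension of \<open>id + \<lambda> N\<close> to \<open>T[\<lambda>]\<close>.\<close>

definition id_plus_lambda :: "('v::ab_group_add \<Rightarrow> 'v) \<Rightarrow> 'v poly \<Rightarrow> 'v poly"
where
  "id_plus_lambda N X = X + pCons 0 (map_poly N X)"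

definition trivial_deformation ::
  "('k::field \<Rightarrow> 'v::ab_group_add \<Rightarrow> 'v) \<Rightarrow> ('v \<Rightarrow> 'v \<Rightarrow> 'v \<Rightarrow> 'v) \<Rightarrow>
   ('v \<Rightarrow> 'v \<Rightarrow> 'v \<Rightarrow> 'v) \<Rightarrow> bool"
where
  "trivial_deformation scale br \<omega> \<longleftrightarrow>
     (\<exists>N. Vector_Spaces.linear scale scale N \<and>
       (\<forall>x1 x2 x3.
          id_plus_lambda N (deformed_bracket br \<omega> [:x1:] [:x2:] [:x3:]) =
          poly_extend3 br (id_plus_lambda N [:x1:]) (id_plus_lambda N [:x2:])
            (id_plus_lambda N [:x3:])))"

end

theory Submission
  imports Defs
begin

text \<open>
  Put \<open>\<phi> = id + \<lambda>N\<close> on \<open>T[\<lambda>]\<close>. The Nijenhuis identities are exactly the coefficients of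
  \<open>\<lambda>\<^sup>2\<close> and \<open>\<lambda>\<^sup>3\<close> in \<open>\<phi>[x,y,z]\<^sub>\<lambda> = [\<phi>x,\<phi>y,\<phi>z]\<close>, and the definition of \<open>\<omega>\<close> is the coefficient of \<open>\<lambda>\<close>.
  Since \<open>\<phi>\<close> is injective on \<open>T[\<lambda>]\<close>, the identities of the Lie triple system \<open>T[\<lambda>]\<close> (with the
  undeformed bracket) pull back to the deformed bracket.
\<close>

section \<open>Additive maps commuting with \<lambda>, and sums over coefficients\<close>

lemma poly_additive_induct [case_names const add shift]:
  fixes P :: "'a::ab_group_add poly \<Rightarrow> bool"
  assumes const: "\<And>a. P [:a:]"
    and add: "\<And>X Y. P X \<Longrightarrow> P Y \<Longrightarrow> P (X + Y)"
    and shift: "\<And>X. P X \<Longrightarrow> P (pCons 0 X)"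
  shows "P X"
proof (induction X)
  case 0
  show ?case using const[of 0] by simp
next
  case (pCons a X)
  have "pCons a X = [:a:] + pCons 0 X" by simp
  then show ?case using add[OF const shift[OF pCons.IH]] by metis
qed

text \<open>This is Z[\<lambda>]-linearity. Scalars of the field are left out, so that the same
  notion serves maps on \<open>'k poly\<close> and on \<open>'v poly\<close>, and an identity can be
  extended from constants in a scalar just as in a vector.\<close>

definition poly_additive :: "('a::ab_group_add poly \<Rightarrow> 'b::ab_group_add poly) \<Rightarrow> bool" where
  "poly_additive F \<longleftrightarrow>
     (\<forall>X Y. F (X + Y) = F X + F Y) \<and> (\<forall>X. F (pCons 0 X) = pCons 0 (F X))"

lemma poly_additive_eqI:
  assumes "poly_additive F" and "poly_additive G" and "\<And>a. F [:a:] = G [:a:]"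
  shows "F X = G X"
  using assms by (induction X rule: poly_additive_induct) (simp_all add: poly_additive_def)

text \<open>The arguments are freed one at a time, from the last to the first, so each stage
  compares two maps of a single variable.\<close>

lemma poly_additive3_eqI:
  assumes "\<And>Y Z. poly_additive (\<lambda>X. F X Y Z)" "\<And>Y Z. poly_additive (\<lambda>X. G X Y Z)"
    and "\<And>X Z. poly_additive (\<lambda>Y. F X Y Z)" "\<And>X Z. poly_additive (\<lambda>Y. G X Y Z)"
    and "\<And>X Y. poly_additive (\<lambda>Z. F X Y Z)" "\<And>X Y. poly_additive (\<lambda>Z. G X Y Z)"
    and const: "\<And>x y z. F [:x:] [:y:] [:z:] = G [:x:] [:y:] [:z:]"
  shows "F X Y Z = G X Y Z"
proof -
  have "F [:x:] [:y:] Z = G [:x:] [:y:] Z" for x y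
    using assms(5,6) const by (rule poly_additive_eqI)
  with assms(3,4) have "F [:x:] Y Z = G [:x:] Y Z" for x
    by (rule poly_additive_eqI)
  with assms(1,2) show ?thesis
    by (rule poly_additive_eqI)
qed

text \<open>Sums that stop at the degree are awkward to compare, because a degree can drop under
  addition; padding with zero terms gives a common range. The index is an argument of
  \<open>g\<close> because it also enters the exponent in \<open>monom\<close>.\<close>

lemma sum_coeff_bound:
  fixes g :: "nat \<Rightarrow> 'a::zero \<Rightarrow> 'b::comm_monoid_add"
  assumes "degree X \<le> n" and "\<And>i. g i 0 = 0"
  shows "(\<Sum>i\<le>degree X. g i (coeff X i)) = (\<Sum>i\<le>n. g i (coeff X i))"
  using assms by (intro sum.mono_neutral_left) (auto simp: coeff_eq_0)

lemma sum_coeff_add: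
  fixes g :: "nat \<Rightarrow> 'a::ab_group_add \<Rightarrow> 'b::ab_group_add"
  assumes add: "\<And>i x y. g i (x + y) = g i x + g i y"
  shows "(\<Sum>i\<le>degree (X + Y). g i (coeff (X + Y) i)) =
    (\<Sum>i\<le>degree X. g i (coeff X i)) + (\<Sum>i\<le>degree Y. g i (coeff Y i))"
proof -
  have zero: "g i 0 = 0" for i using add[of i 0 0] by simp
  let ?n = "max (degree X) (degree Y)"
  have bound: "(\<Sum>i\<le>degree Z. g i (coeff Z i)) = (\<Sum>i\<le>?n. g i (coeff Z i))"
    if "degree Z \<le> ?n" for Z
    using that zero by (rule sum_coeff_bound)
  show ?thesis
    unfolding bound[OF degree_add_le_max] bound[OF max.cobounded1] bound[OF max.cobounded2]
    by (simp add: add sum.distrib)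
qed

lemma sum_coeff_shift:
  fixes g :: "nat \<Rightarrow> 'a::ab_group_add \<Rightarrow> 'b::ab_group_add"
  assumes zero: "\<And>i. g i 0 = 0"
  shows "(\<Sum>i\<le>degree (pCons 0 X). g i (coeff (pCons 0 X) i)) =
    (\<Sum>i\<le>degree X. g (Suc i) (coeff X i))"
proof -
  \<comment> \<open>The bound \<open>Suc (degree X)\<close> also covers \<open>X = 0\<close>, where
    \<open>pCons 0 X\<close> is zero and its degree is 0 rather than 1.\<close>
  have "(\<Sum>i\<le>degree (pCons 0 X). g i (coeff (pCons 0 X) i)) =
      (\<Sum>i\<le>Suc (degree X). g i (coeff (pCons 0 X) i))"
    using zero by (intro sum_coeff_bound) (simp_all add: degree_pCons_le)
  also have "\<dots> = (\<Sum>i\<le>degree X. g (Suc i) (coeff X i))"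
    by (simp only: sum.atMost_Suc_shift) (simp add: zero)
  finally show ?thesis .
qed

lemma pCons_0_sum: "pCons 0 (\<Sum>i\<in>A. h i) = (\<Sum>i\<in>A. pCons 0 (h i))"
  for h :: "'b \<Rightarrow> 'a::ab_group_add poly"
  using sum_comp_morphism[of "pCons 0" h A] by (simp add: o_def)

section \<open>The \<lambda>-linear extension of a map additive in each argument\<close>

locale triadditive =
  fixes f :: "'v::ab_group_add \<Rightarrow> 'v \<Rightarrow> 'v \<Rightarrow> 'v"
  assumes add1: "f (x + x') y z = f x y z + f x' y z"
    and add2: "f x (y + y') z = f x y z + f x y' z"
    and add3: "f x y (z + z') = f x y z + f x y z'"
begin

lemma zero1: "f 0 y z = 0" using add1[of 0 0 y z] by simp
lemma zero2: "f x 0 z = 0" using add2[of x 0 0 z] by simp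
lemma zero3: "f x y 0 = 0" using add3[of x y 0 0] by simp

text \<open>Together with \<open>extend_add\<close> and \<open>extend_shift\<close> this determines
  the extension; later arguments work with these rules instead of the triple sum.\<close>

lemma extend_const [simp]: "poly_extend3 f [:x:] [:y:] [:z:] = [:f x y z:]"
  by (simp add: poly_extend3_def monom_0)

lemma extend_add [simp]:
  "poly_extend3 f (X + X') Y Z = poly_extend3 f X Y Z + poly_extend3 f X' Y Z"
  "poly_extend3 f X (Y + Y') Z = poly_extend3 f X Y Z + poly_extend3 f X Y' Z"
  "poly_extend3 f X Y (Z + Z') = poly_extend3 f X Y Z + poly_extend3 f X Y Z'"
proof -
  show "poly_extend3 f (X + X') Y Z = poly_extend3 f X Y Z + poly_extend3 f X' Y Z"
    unfolding poly_extend3_def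
    by (rule sum_coeff_add[of "\<lambda>i x. \<Sum>j\<le>degree Y. \<Sum>k\<le>degree Z.
          monom (f x (coeff Y j) (coeff Z k)) (i + j + k)"])
      (simp add: add1 add_monom[symmetric] sum.distrib)
  show "poly_extend3 f X (Y + Y') Z = poly_extend3 f X Y Z + poly_extend3 f X Y' Z"
    unfolding poly_extend3_def sum.distrib[symmetric]
    by (intro sum.cong refl sum_coeff_add[of "\<lambda>j y. \<Sum>k\<le>degree Z.
          monom (f (coeff X i) y (coeff Z k)) (i + j + k)" for i])
      (simp add: add2 add_monom[symmetric] sum.distrib)
  show "poly_extend3 f X Y (Z + Z') = poly_extend3 f X Y Z + poly_extend3 f X Y Z'"
    unfolding poly_extend3_def sum.distrib[symmetric]
    by (intro sum.cong refl sum_coeff_add[of "\<lambda>k z.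
          monom (f (coeff X i) (coeff Y j) z) (i + j + k)" for i j])
      (simp add: add3 add_monom[symmetric])
qed

lemma extend_shift [simp]:
  "poly_extend3 f (pCons 0 X) Y Z = pCons 0 (poly_extend3 f X Y Z)"
  "poly_extend3 f X (pCons 0 Y) Z = pCons 0 (poly_extend3 f X Y Z)"
  "poly_extend3 f X Y (pCons 0 Z) = pCons 0 (poly_extend3 f X Y Z)"
proof -
  show "poly_extend3 f (pCons 0 X) Y Z = pCons 0 (poly_extend3 f X Y Z)"
    unfolding poly_extend3_def
    by (subst sum_coeff_shift[of "\<lambda>i x. \<Sum>j\<le>degree Y. \<Sum>k\<le>degree Z.
          monom (f x (coeff Y j) (coeff Z k)) (i + j + k)"])
      (simp_all add: zero1 pCons_0_sum monom_Suc)
  show "poly_extend3 f X (pCons 0 Y) Z = pCons 0 (poly_extend3 f X Y Z)"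
    unfolding poly_extend3_def pCons_0_sum
    by (rule sum.cong[OF refl], rule trans, rule sum_coeff_shift[of "\<lambda>j y. \<Sum>k\<le>degree Z.
          monom (f (coeff X i) y (coeff Z k)) (i + j + k)" for i])
      (simp_all add: zero2 monom_Suc)
  show "poly_extend3 f X Y (pCons 0 Z) = pCons 0 (poly_extend3 f X Y Z)"
    unfolding poly_extend3_def pCons_0_sum
    by (rule sum.cong[OF refl], rule sum.cong[OF refl], rule trans,
        rule sum_coeff_shift[of "\<lambda>k z. monom (f (coeff X i) (coeff Y j) z) (i + j + k)" for i j])
      (simp_all add: zero3 monom_Suc)
qed

end

section \<open>Scalar extension to T[\<lambda>]: module structure, trilinear maps, Lie triple
  system\<close>

context module
begin

lemma poly_scale_const [simp]: "poly_scale scale [:a:] [:x:] = [:scale a x:]"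
  by (simp add: poly_scale_def monom_0)

lemma poly_scale_add [simp]:
  "poly_scale scale (p + q) X = poly_scale scale p X + poly_scale scale q X"
  "poly_scale scale p (X + Y) = poly_scale scale p X + poly_scale scale p Y"
proof -
  show "poly_scale scale (p + q) X = poly_scale scale p X + poly_scale scale q X"
    unfolding poly_scale_def
    by (rule sum_coeff_add[of "\<lambda>i a. \<Sum>j\<le>degree X. monom (scale a (coeff X j)) (i + j)"])
      (simp add: scale_left_distrib add_monom[symmetric] sum.distrib)
  show "poly_scale scale p (X + Y) = poly_scale scale p X + poly_scale scale p Y"
    unfolding poly_scale_def sum.distrib[symmetric]
    by (intro sum.cong refl
        sum_coeff_add[of "\<lambda>j x. monom (scale (coeff p i) x) (i + j)" for i])
      (simp add: scale_right_distrib add_monom[symmetric])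
qed

lemma poly_scale_shift [simp]:
  "poly_scale scale (pCons 0 p) X = pCons 0 (poly_scale scale p X)"
  "poly_scale scale p (pCons 0 X) = pCons 0 (poly_scale scale p X)"
proof -
  show "poly_scale scale (pCons 0 p) X = pCons 0 (poly_scale scale p X)"
    unfolding poly_scale_def
    by (subst sum_coeff_shift[of "\<lambda>i a. \<Sum>j\<le>degree X. monom (scale a (coeff X j)) (i + j)"])
      (simp_all add: pCons_0_sum monom_Suc)
  show "poly_scale scale p (pCons 0 X) = pCons 0 (poly_scale scale p X)"
    unfolding poly_scale_def pCons_0_sum
    by (rule sum.cong[OF refl], rule trans,
        rule sum_coeff_shift[of "\<lambda>j x. monom (scale (coeff p i) x) (i + j)" for i])
      (simp_all add: monom_Suc)
qed

lemma module_poly_scale: "module (poly_scale scale)"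
proof
  fix p q :: "'a poly" and X Y :: "'b poly"
  \<comment> \<open>Associativity of the action is extended from constants to polynomials in
    \<open>X\<close>, then in \<open>q\<close>, then in \<open>p\<close>.\<close>
  have 1: "poly_scale scale [:a:] (poly_scale scale [:b:] X) = poly_scale scale ([:a:] * [:b:]) X"
    for a b
    by (rule poly_additive_eqI[where X = X]) (simp_all add: poly_additive_def mult.commute)
  have 2: "poly_scale scale [:a:] (poly_scale scale q X) = poly_scale scale ([:a:] * q) X" for a
    by (rule poly_additive_eqI[where X = q])
      (use 1 in \<open>simp_all add: poly_additive_def smult_add_right\<close>)
  show "poly_scale scale p (poly_scale scale q X) = poly_scale scale (p * q) X"
    by (rule poly_additive_eqI[where X = p])
      (use 2 in \<open>simp_all add: poly_additive_def distrib_right\<close>)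
  show "poly_scale scale 1 X = X"
    unfolding one_pCons
    by (rule poly_additive_eqI[where X = X]) (simp_all add: poly_additive_def)
qed simp_all

lemma trilinear_imp_triadditive:
  assumes "trilinear scale f"
  shows "triadditive f"
proof
  have f: "module_hom scale scale (\<lambda>x. f x y z)" "module_hom scale scale (\<lambda>y. f x y z)"
    "module_hom scale scale (\<lambda>z. f x y z)" for x y z
    using assms by (simp_all add: trilinear_def)
  show "f (x + x') y z = f x y z + f x' y z" for x x' y z
    by (rule module_hom.add[OF f(1)])
  show "f x (y + y') z = f x y z + f x y' z" for x y y' z
    by (rule module_hom.add[OF f(2)])
  show "f x y (z + z') = f x y z + f x y z'" for x y z z'
    by (rule module_hom.add[OF f(3)])
qed

lemma poly_extend3_scale:
  assumes "trilinear scale f"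
  shows "poly_extend3 f (poly_scale scale p X) Y Z = poly_scale scale p (poly_extend3 f X Y Z)"
    and "poly_extend3 f X (poly_scale scale p Y) Z = poly_scale scale p (poly_extend3 f X Y Z)"
    and "poly_extend3 f X Y (poly_scale scale p Z) = poly_scale scale p (poly_extend3 f X Y Z)"
proof -
  interpret triadditive f using assms by (rule trilinear_imp_triadditive)
  have f_scale: "f (scale a x) y z = scale a (f x y z)" "f x (scale a y) z = scale a (f x y z)"
    "f x y (scale a z) = scale a (f x y z)" for a x y z
    using assms unfolding trilinear_def by (metis module_hom.scale)+
  let ?S = "poly_scale scale" and ?E = "poly_extend3 f"
  \<comment> \<open>For a constant scalar both sides can be compared on constant vectors; both sides
    are then additive in \<open>p\<close> and commute with \<lambda>, which gives all polynomial
    scalars.\<close>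
  have 1: "?E (?S [:a:] X) Y Z = ?S [:a:] (?E X Y Z)" for a
    by (rule poly_additive3_eqI[where F = "\<lambda>X Y Z. ?E (?S [:a:] X) Y Z"
          and G = "\<lambda>X Y Z. ?S [:a:] (?E X Y Z)"])
      (simp_all add: poly_additive_def f_scale)
  show "?E (?S p X) Y Z = ?S p (?E X Y Z)"
    by (rule poly_additive_eqI[where X = p]) (simp_all add: poly_additive_def 1)
  have 2: "?E X (?S [:a:] Y) Z = ?S [:a:] (?E X Y Z)" for a
    by (rule poly_additive3_eqI[where F = "\<lambda>X Y Z. ?E X (?S [:a:] Y) Z"
          and G = "\<lambda>X Y Z. ?S [:a:] (?E X Y Z)"])
      (simp_all add: poly_additive_def f_scale)
  show "?E X (?S p Y) Z = ?S p (?E X Y Z)"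
    by (rule poly_additive_eqI[where X = p]) (simp_all add: poly_additive_def 2)
  have 3: "?E X Y (?S [:a:] Z) = ?S [:a:] (?E X Y Z)" for a
    by (rule poly_additive3_eqI[where F = "\<lambda>X Y Z. ?E X Y (?S [:a:] Z)"
          and G = "\<lambda>X Y Z. ?S [:a:] (?E X Y Z)"])
      (simp_all add: poly_additive_def f_scale)
  show "?E X Y (?S p Z) = ?S p (?E X Y Z)"
    by (rule poly_additive_eqI[where X = p]) (simp_all add: poly_additive_def 3)
qed

lemma trilinear_poly_extend3:
  assumes "trilinear scale f"
  shows "trilinear (poly_scale scale) (poly_extend3 f)"
proof -
  interpret triadditive f using assms by (rule trilinear_imp_triadditive)
  interpret P: module "poly_scale scale" by (rule module_poly_scale)
  show ?thesis
    unfolding trilinear_def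
    by (auto intro!: module_hom.intro module_hom_axioms.intro P.module_axioms
        simp: poly_extend3_scale[OF assms])
qed

lemma trilinear_deformed_bracket:
  assumes "trilinear scale f" and "trilinear scale g"
  shows "trilinear (poly_scale scale) (deformed_bracket f g)"
proof -
  interpret f: triadditive f using assms(1) by (rule trilinear_imp_triadditive)
  interpret g: triadditive g using assms(2) by (rule trilinear_imp_triadditive)
  interpret P: module "poly_scale scale" by (rule module_poly_scale)
  show ?thesis
    unfolding trilinear_def deformed_bracket_def
    by (auto intro!: module_hom.intro module_hom_axioms.intro P.module_axioms
        simp: poly_extend3_scale[OF assms(1)] poly_extend3_scale[OF assms(2)])
qed

end

text \<open>The cyclic and derivation identities are additive in every variable, so they extend from
  constants. The alternating law is quadratic in its repeated argument and needs its polarized form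
  as well.\<close>

lemma (in lie_triple_system) lie_triple_system_poly:
  "lie_triple_system (poly_scale scale) (poly_extend3 br)"
proof -
  interpret P: module "poly_scale scale" by (rule module_poly_scale)
  interpret triadditive br using trilinear by (rule trilinear_imp_triadditive)
  have skew_br: "br x y z + br y x z = 0" for x y z
  proof -
    have "br x y z + br y x z = br (x + y) (x + y) z"
      unfolding add1 add2 by (simp add: alternating)
    then show ?thesis by (simp only: alternating)
  qed
  let ?E = "poly_extend3 br"
  have skew: "?E X Y Z + ?E Y X Z = 0" for X Y Z
    by (rule poly_additive3_eqI[where F = "\<lambda>X Y Z. ?E X Y Z + ?E Y X Z" and G = "\<lambda>X Y Z. 0"])
      (simp_all add: poly_additive_def skew_br algebra_simps)
  have alt_const: "?E [:x:] [:x:] Z = 0" for x Z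
    by (induction Z rule: poly_additive_induct) (simp_all add: alternating)
  \<comment> \<open>In the sum case the two cross terms cancel by \<open>skew\<close>; a shift only
    multiplies the value by \<lambda> twice.\<close>
  have alt: "?E X X Z = 0" for X Z
  proof (induction X rule: poly_additive_induct)
    case (add X Y)
    then show ?case using skew[of X Y Z] by (simp add: add.commute)
  qed (simp_all add: alt_const)
  have cyc: "?E X Y Z + ?E Y Z X + ?E Z X Y = 0" for X Y Z
    by (rule poly_additive3_eqI[where F = "\<lambda>X Y Z. ?E X Y Z + ?E Y Z X + ?E Z X Y"
          and G = "\<lambda>X Y Z. 0"])
      (simp_all add: poly_additive_def cyclic[unfolded add.assoc] algebra_simps)

  let ?L = "\<lambda>X1 X2 Y1 Y2 Y3. ?E X1 X2 (?E Y1 Y2 Y3)"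
  let ?R = "\<lambda>X1 X2 Y1 Y2 Y3.
    ?E (?E X1 X2 Y1) Y2 Y3 + ?E Y1 (?E X1 X2 Y2) Y3 + ?E Y1 Y2 (?E X1 X2 Y3)"
  \<comment> \<open>The identity has five variables: the inner three are freed together, then
    \<open>X2\<close>, then \<open>X1\<close>.\<close>
  have 1: "?L [:x1:] [:x2:] Y1 Y2 Y3 = ?R [:x1:] [:x2:] Y1 Y2 Y3" for x1 x2 Y1 Y2 Y3
    by (rule poly_additive3_eqI[where F = "?L [:x1:] [:x2:]" and G = "?R [:x1:] [:x2:]"])
      (simp_all add: poly_additive_def derivation[of x1 x2])
  have 2: "?L [:x1:] X2 Y1 Y2 Y3 = ?R [:x1:] X2 Y1 Y2 Y3" for x1 X2 Y1 Y2 Y3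
    by (rule poly_additive_eqI[where X = X2]) (use 1 in \<open>simp_all add: poly_additive_def\<close>)
  have der: "?L X1 X2 Y1 Y2 Y3 = ?R X1 X2 Y1 Y2 Y3" for X1 X2 Y1 Y2 Y3
    by (rule poly_additive_eqI[where X = X1]) (use 2 in \<open>simp_all add: poly_additive_def\<close>)
  show ?thesis
    by unfold_locales (fact trilinear_poly_extend3[OF trilinear] alt cyc der)+
qed

section \<open>The map id + \<lambda>N and transport of the axioms along it\<close>

lemma id_plus_lambda_simps:
  assumes "\<And>x y. N (x + y) = N x + N y"
  shows "id_plus_lambda N [:x:] = [:x:] + pCons 0 [:N x:]"
    and "id_plus_lambda N (X + Y) = id_plus_lambda N X + id_plus_lambda N Y"
    and "id_plus_lambda N (pCons 0 X) = pCons 0 (id_plus_lambda N X)"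
proof -
  have zero: "N 0 = 0" using assms[of 0 0] by simp
  have add: "map_poly N (X + Y) = map_poly N X + map_poly N Y"
    by (rule poly_eqI) (simp add: coeff_map_poly zero assms)
  show "id_plus_lambda N [:x:] = [:x:] + pCons 0 [:N x:]"
    using zero by (simp add: id_plus_lambda_def map_poly_pCons)
  show "id_plus_lambda N (X + Y) = id_plus_lambda N X + id_plus_lambda N Y"
    by (simp add: id_plus_lambda_def add)
  show "id_plus_lambda N (pCons 0 X) = pCons 0 (id_plus_lambda N X)"
    by (simp add: id_plus_lambda_def map_poly_pCons zero)
qed

text \<open>Adding a multiple of \<lambda> does not change the constant coefficient, so an element
  of the kernel has constant coefficient 0. It is therefore \<lambda> times a polynomial that is
  again in the kernel, and induction applies.\<close>

lemma inj_id_plus_lambda: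
  assumes "\<And>x y. N (x + y) = N x + N y"
  shows "inj (id_plus_lambda N)"
proof -
  note \<phi> = id_plus_lambda_simps[of N, OF assms]
  have ker: "id_plus_lambda N X = 0 \<Longrightarrow> X = 0" for X
  proof (induction X)
    case 0
    show ?case by simp
  next
    case (pCons a X)
    have "coeff (id_plus_lambda N (pCons a X)) 0 = a"
      by (simp add: id_plus_lambda_def)
    with pCons.prems have "a = 0" by simp
    with pCons show ?case by (simp add: \<phi>)
  qed
  have "X = Y" if "id_plus_lambda N X = id_plus_lambda N Y" for X Y
    using that \<phi>(2)[of "X - Y" Y] ker[of "X - Y"] by simp
  then show ?thesis by (simp add: inj_def)
qed

text \<open>The Lie triple system axioms only involve the bracket and addition, so they are reflected by
  injective additive maps; only trilinearity has to be known separately.\<close>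

lemma lie_triple_system_pullback:
  assumes "lie_triple_system scale' br'" and "module scale" and "trilinear scale br"
    and "inj \<phi>" and add: "\<And>x y. \<phi> (x + y) = \<phi> x + \<phi> y"
    and hom: "\<And>x y z. \<phi> (br x y z) = br' (\<phi> x) (\<phi> y) (\<phi> z)"
  shows "lie_triple_system scale br"
proof -
  interpret T: lie_triple_system scale' br' by fact
  interpret module scale by fact
  have zero: "\<phi> 0 = 0" using add[of 0 0] by simp
  have eqI: "x = y" if "\<phi> x = \<phi> y" for x y using \<open>inj \<phi>\<close> that by (rule injD)
  show ?thesis
  proof
    show "trilinear scale br" by fact
    show "br x1 x1 x2 = 0" for x1 x2
      by (rule eqI) (simp add: hom zero T.alternating)
    show "br x1 x2 x3 + br x2 x3 x1 + br x3 x1 x2 = 0" for x1 x2 x3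
      by (rule eqI) (simp add: hom add zero T.cyclic)
    show "br x1 x2 (br y1 y2 y3) =
        br (br x1 x2 y1) y2 y3 + br y1 (br x1 x2 y2) y3 + br y1 y2 (br x1 x2 y3)"
      for x1 x2 y1 y2 y3
      by (rule eqI) (simp only: hom add, rule T.derivation)
  qed
qed

section \<open>The deformation generated by a Nijenhuis operator\<close>

theorem theorem3p3:
  fixes scale :: "'k::alg_closed_field \<Rightarrow> 'v::ab_group_add \<Rightarrow> 'v"
    and br \<omega> :: "'v \<Rightarrow> 'v \<Rightarrow> 'v \<Rightarrow> 'v"
    and N :: "'v \<Rightarrow> 'v"
  assumes "CHAR('k) \<noteq> 2" and "CHAR('k) \<noteq> 3"
    and "vector_space scale"
    and "lie_triple_system scale br"
    and "nijenhuis_operator scale br N"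
    and "\<And>x1 x2 x3. \<omega> x1 x2 x3 =
           br (N x1) x2 x3 + br x1 (N x2) x3 + br x1 x2 (N x3) - N (br x1 x2 x3)"
  shows "generates_deformation scale br \<omega> \<and> trivial_deformation scale br \<omega>"
proof -
  note \<omega>_def = assms(6)
  interpret lie_triple_system scale br by fact
  interpret br: triadditive br using trilinear by (rule trilinear_imp_triadditive)
  have N: "Vector_Spaces.linear scale scale N"
    and N3: "br (N x1) (N x2) (N x3) = 0"
    and N2: "N (N (br x1 x2 x3)) =
        N (br (N x1) x2 x3) + N (br x1 (N x2) x3) + N (br x1 x2 (N x3))
        - (br (N x1) (N x2) x3 + br (N x1) x2 (N x3) + br x1 (N x2) (N x3))" for x1 x2 x3
    using assms(5) unfolding nijenhuis_operator_def by blast+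
  interpret N: Vector_Spaces.linear scale scale N by fact
  have br_scale: "br (scale a x) y z = scale a (br x y z)" "br x (scale a y) z = scale a (br x y z)"
    "br x y (scale a z) = scale a (br x y z)" for a x y z
    using trilinear unfolding trilinear_def by (metis module_hom.scale)+
  have tri: "trilinear scale \<omega>"
    unfolding trilinear_def
    by (auto intro!: module_hom.intro module_hom_axioms.intro module_axioms
        simp: \<omega>_def br.add1 br.add2 br.add3 N.add N.scale br_scale
          scale_right_distrib scale_right_diff_distrib)
  interpret \<omega>: triadditive \<omega> using tri by (rule trilinear_imp_triadditive)
  let ?\<phi> = "id_plus_lambda N" and ?D = "deformed_bracket br \<omega>"
  note \<phi> = id_plus_lambda_simps[of N, OF N.add]
  \<comment> \<open>The identity is established on all of T[\<lambda>], as the pullback of the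
    axioms requires; its restriction to constants is triviality.\<close>
  have hom: "?\<phi> (?D X Y Z) = poly_extend3 br (?\<phi> X) (?\<phi> Y) (?\<phi> Z)" for X Y Z
  proof (rule poly_additive3_eqI[where F = "\<lambda>X Y Z. ?\<phi> (?D X Y Z)"
        and G = "\<lambda>X Y Z. poly_extend3 br (?\<phi> X) (?\<phi> Y) (?\<phi> Z)"])
    fix x y z
    have lin: "\<omega> x y z + N (br x y z) = br (N x) y z + br x (N y) z + br x y (N z)"
      by (simp add: \<omega>_def)
    \<comment> \<open>Applying \<open>N\<close> to the definition of \<open>\<omega>\<close>
      produces \<open>N (N (br x y z))\<close> with a minus sign; expanding it by \<open>N2\<close>
      cancels the terms with a single outer \<open>N\<close>.\<close>
    have quad: "N (\<omega> x y z) = br (N x) (N y) z + br (N x) y (N z) + br x (N y) (N z)"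
      by (simp add: \<omega>_def N.add N.diff N2)
    have "?\<phi> (?D [:x:] [:y:] [:z:]) = ?\<phi> [:br x y z:] + pCons 0 (?\<phi> [:\<omega> x y z:])"
      unfolding deformed_bracket_def br.extend_const \<omega>.extend_const \<phi>(2,3) ..
    also have "\<dots> = [:br x y z, \<omega> x y z + N (br x y z), N (\<omega> x y z):]"
      by (simp add: \<phi>(1) add.commute)
    \<comment> \<open>Expanding the right-hand side gives eight brackets, grouped by how many
      arguments carry \<open>N\<close>; the \<lambda>-cubed term \<open>br (N x) (N y) (N z)\<close>
      vanishes by \<open>N3\<close>.\<close>
    also have "\<dots> = poly_extend3 br (?\<phi> [:x:]) (?\<phi> [:y:]) (?\<phi> [:z:])"
      unfolding lin quad \<phi> by (simp only: br.extend_add br.extend_shift br.extend_const)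
        (simp add: N3 algebra_simps)
    finally show "?\<phi> (?D [:x:] [:y:] [:z:]) =
        poly_extend3 br (?\<phi> [:x:]) (?\<phi> [:y:]) (?\<phi> [:z:])" .
  qed (simp_all add: poly_additive_def deformed_bracket_def \<phi>)
  have "lie_triple_system (poly_scale scale) ?D"
    by (rule lie_triple_system_pullback[where \<phi> = ?\<phi>, OF lie_triple_system_poly
          module_poly_scale trilinear_deformed_bracket[OF trilinear tri]
          inj_id_plus_lambda[of N, OF N.add] \<phi>(2) hom])
  with tri have "generates_deformation scale br \<omega>"
    by (simp add: generates_deformation_def)
  \<comment> \<open>The witness for the trivializing map is \<open>N\<close> itself.\<close>
  moreover have "trivial_deformation scale br \<omega>"
    unfolding trivial_deformation_def by (rule exI[of _ N]) (simp only: N hom simp_thms)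
  ultimately show ?thesis ..
qed

end
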